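(* Let $X$ be an involutive BE algebra which is implicative. If $X$ is an implicative-orthomodular algebra, then $X$ is a pre-Wajsberg algebra and a meta-Wajsberg algebra.
   Context: A BE algebra is an algebra $(X,\to,1)$ of type $(2,0)$ such that for all $x,y,z\in X$: $x\to x=1$; $x\to 1=1$; $1\to x=x$; $x\to (y\to z)=y\to (x\to z)$. Write $x\le y$ iff $x\to y=1$. It is bounded if there is $0\in X$ with $0\le x$ for all $x\in X$; then $x^*:=x\to 0$. It is involutive if it is bounded and $x^{**}=x$ for all $x\in X$; an involutive BE algebra is denoted $(X,\to,^*,1)$. In an involutive BE algebra define $x\Cap y=((x^*\to y^* )\to y^* )^*$. A BE algebra is implicative if $(x\to y)\to x=x$ for all $x,y\in X$. An involutive BE algebra $X$ is called: - implicative-orthomodular if $x\to (y\Cap (z\Cap x))=(x\to y)\Cap (x\to z)$ for all $x,y,z\in X$; - pre-Wajsberg if $x\to (x\Cap y)=x\to y$ for all $x,y\in X$; - meta-Wajsberg if $(x\Cap y)\to (y\Cap x)=1$ for all $x,y\in X$. *)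

theory Defs
  imports Main
begin

locale BE_algebra =
  fixes X :: "'a set"
    and imp :: "'a \<Rightarrow> 'a \<Rightarrow> 'a"  (infixr "\<rightarrow>" 60)
    and one :: 'a  ("\<one>")
  assumes imp_closed: "\<lbrakk>x \<in> X; y \<in> X\<rbrakk> \<Longrightarrow> x \<rightarrow> y \<in> X"
    and one_closed: "\<one> \<in> X"
    and imp_self: "x \<in> X \<Longrightarrow> x \<rightarrow> x = \<one>"
    and imp_one: "x \<in> X \<Longrightarrow> x \<rightarrow> \<one> = \<one>"
    and one_imp: "x \<in> X \<Longrightarrow> \<one> \<rightarrow> x = x"
    and exchange: "\<lbrakk>x \<in> X; y \<in> X; z \<in> X\<rbrakk> \<Longrightarrow> x \<rightarrow> (y \<rightarrow> z) = y \<rightarrow> (x \<rightarrow> z)"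
begin

definition le :: "'a \<Rightarrow> 'a \<Rightarrow> bool"  (infix "\<preceq>" 50)
  where "x \<preceq> y \<longleftrightarrow> x \<rightarrow> y = \<one>"

end

locale implicative_BE_algebra = BE_algebra +
  assumes implicative: "\<lbrakk>x \<in> X; y \<in> X\<rbrakk> \<Longrightarrow> (x \<rightarrow> y) \<rightarrow> x = x"

text \<open>The relation \<open>\<preceq>\<close> need not be antisymmetric, so the bottom element is a parameter.
  In the involutive case it is unique: a second bottom element \<open>b\<close> has
  \<open>b\<^sup>\<star> = \<one>\<close>, hence \<open>b = \<one>\<^sup>\<star> = \<zero>\<close>.\<close>

locale bounded_BE_algebra = BE_algebra +
  fixes zero :: 'a  ("\<zero>")
  assumes zero_closed: "\<zero> \<in> X"
    and zero_le: "x \<in> X \<Longrightarrow> \<zero> \<preceq> x"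
begin

definition star :: "'a \<Rightarrow> 'a"  ("_\<^sup>\<star>" [1000] 999)
  where "x\<^sup>\<star> = x \<rightarrow> \<zero>"

definition Cap :: "'a \<Rightarrow> 'a \<Rightarrow> 'a"  (infixl "\<sqinter>" 70)
  where "x \<sqinter> y = ((x\<^sup>\<star> \<rightarrow> y\<^sup>\<star>) \<rightarrow> y\<^sup>\<star>)\<^sup>\<star>"

end

locale involutive_BE_algebra = bounded_BE_algebra +
  assumes involutive: "x \<in> X \<Longrightarrow> (x\<^sup>\<star>)\<^sup>\<star> = x"

locale implicative_orthomodular_algebra = involutive_BE_algebra +
  assumes implicative_orthomodular:
    "\<lbrakk>x \<in> X; y \<in> X; z \<in> X\<rbrakk> \<Longrightarrow> x \<rightarrow> (y \<sqinter> (z \<sqinter> x)) = (x \<rightarrow> y) \<sqinter> (x \<rightarrow> z)"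

locale pre_Wajsberg_algebra = involutive_BE_algebra +
  assumes pre_Wajsberg: "\<lbrakk>x \<in> X; y \<in> X\<rbrakk> \<Longrightarrow> x \<rightarrow> (x \<sqinter> y) = x \<rightarrow> y"

locale meta_Wajsberg_algebra = involutive_BE_algebra +
  assumes meta_Wajsberg: "\<lbrakk>x \<in> X; y \<in> X\<rbrakk> \<Longrightarrow> (x \<sqinter> y) \<rightarrow> (y \<sqinter> x) = \<one>"

end

theory Submission
  imports Defs
begin

text \<open>Read \<open>x \<rightarrow> y\<close> as \<open>x\<^sup>\<star> \<squnion> y\<close>. Implicativity is then the absorption law, the
  implicative-orthomodular law is the orthomodular law, and \<open>x \<sqinter> y\<close> is the Sasaki projection of
  \<open>x\<close> to \<open>y\<close>. Orthomodularity splits \<open>y\<close> as the join of \<open>x \<sqinter> y\<close> and \<open>(y \<rightarrow> x)\<^sup>\<star>\<close>;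
  the second part lies below \<open>x\<^sup>\<star>\<close>, so joining with \<open>x\<^sup>\<star>\<close> yields the pre-Wajsberg identity.
  The meta-Wajsberg identity follows from the pre-Wajsberg one by residuation.\<close>

context bounded_BE_algebra
begin

lemma star_closed: "x \<in> X \<Longrightarrow> x\<^sup>\<star> \<in> X"
  by (simp add: star_def imp_closed zero_closed)

lemma Cap_closed: "\<lbrakk>x \<in> X; y \<in> X\<rbrakk> \<Longrightarrow> x \<sqinter> y \<in> X"
  by (simp add: Cap_def imp_closed star_closed)

lemma imp_star_commute: "\<lbrakk>x \<in> X; y \<in> X\<rbrakk> \<Longrightarrow> x \<rightarrow> y\<^sup>\<star> = y \<rightarrow> x\<^sup>\<star>"
  by (simp add: star_def exchange zero_closed)

lemma star_one: "\<one>\<^sup>\<star> = \<zero>"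
  by (simp add: star_def one_imp zero_closed)

end

context involutive_BE_algebra
begin

lemma contraposition: "\<lbrakk>x \<in> X; y \<in> X\<rbrakk> \<Longrightarrow> x\<^sup>\<star> \<rightarrow> y\<^sup>\<star> = y \<rightarrow> x"
  by (simp add: imp_star_commute star_closed involutive)

lemma Cap_eq: "\<lbrakk>x \<in> X; y \<in> X\<rbrakk> \<Longrightarrow> x \<sqinter> y = ((y \<rightarrow> x) \<rightarrow> y\<^sup>\<star>)\<^sup>\<star>"
  by (simp add: Cap_def contraposition)

lemma one_Cap: "x \<in> X \<Longrightarrow> \<one> \<sqinter> x = x"
  by (simp add: Cap_eq one_closed imp_one one_imp star_closed involutive)

lemma Cap_one: "x \<in> X \<Longrightarrow> x \<sqinter> \<one> = x"
  by (simp add: Cap_eq one_closed one_imp star_one star_def[symmetric] involutive)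

text \<open>Currying, with \<open>(x \<rightarrow> y\<^sup>\<star>)\<^sup>\<star>\<close> as the
  product of \<open>x\<close> and \<open>y\<close>: contraposition makes
  \<open>z\<^sup>\<star>\<close> an antecedent, which exchange moves past \<open>x\<close>.\<close>

lemma star_imp:
  assumes "x \<in> X" "y \<in> X" "z \<in> X"
  shows "(x \<rightarrow> y\<^sup>\<star>)\<^sup>\<star> \<rightarrow> z = x \<rightarrow> (y \<rightarrow> z)"
proof -
  have "(x \<rightarrow> y\<^sup>\<star>)\<^sup>\<star> \<rightarrow> z = z\<^sup>\<star> \<rightarrow> (x \<rightarrow> y\<^sup>\<star>)"
    using assms by (metis contraposition imp_closed involutive star_closed)
  also have "\<dots> = x \<rightarrow> (z\<^sup>\<star> \<rightarrow> y\<^sup>\<star>)"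
    using assms by (simp add: exchange star_closed)
  finally show ?thesis
    using assms by (simp add: contraposition)
qed

end

sublocale pre_Wajsberg_algebra \<subseteq> meta_Wajsberg_algebra
proof
  fix x y
  assume xy: "x \<in> X" "y \<in> X"
  \<comment> \<open>By \<open>Cap_eq\<close>, \<open>x \<sqinter> y\<close> is the product of
    \<open>y \<rightarrow> x\<close> and \<open>y\<close>, so it can be curried.\<close>
  then have "(x \<sqinter> y) \<rightarrow> (y \<sqinter> x) = (y \<rightarrow> x) \<rightarrow> (y \<rightarrow> (y \<sqinter> x))"
    by (simp add: Cap_eq[of x y] star_imp imp_closed Cap_closed)
  then show "(x \<sqinter> y) \<rightarrow> (y \<sqinter> x) = \<one>"
    using xy by (simp add: pre_Wajsberg imp_self imp_closed)
qed

text \<open>The case \<open>z = \<one>\<close> of the defining law, where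
  \<open>\<one> \<sqinter> x\<close> and the factor \<open>x \<rightarrow> \<one>\<close>
  collapse.\<close>

lemma (in implicative_orthomodular_algebra) imp_Cap:
  assumes "x \<in> X" "y \<in> X"
  shows "x \<rightarrow> (y \<sqinter> x) = x \<rightarrow> y"
  using implicative_orthomodular[OF assms one_closed] assms
  by (simp add: one_Cap Cap_one imp_one imp_closed)

locale implicative_IOM_algebra =
  implicative_orthomodular_algebra + implicative_BE_algebra
begin

lemma imp_Cap_eq:
  assumes "x \<in> X" "y \<in> X"
  shows "(y \<rightarrow> x) \<rightarrow> (x \<sqinter> y) = y"
proof -
  have p: "y \<rightarrow> x \<in> X" "(y \<rightarrow> x) \<rightarrow> y = y"
    using assms by (simp_all add: imp_closed implicative)
  \<comment> \<open>Implicativity shrinks the inner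
    \<open>(y \<rightarrow> x) \<rightarrow> y\<close> to \<open>y\<close>; swapping the two
    antecedents then gives the formula for \<open>x \<sqinter> y\<close>. Hence
    \<open>imp_Cap\<close> is used with \<open>y \<rightarrow> x\<close> in place of
    \<open>x\<close>.\<close>
  then have "y \<sqinter> (y \<rightarrow> x) = x \<sqinter> y"
    using assms by (simp add: Cap_eq imp_star_commute)
  then show ?thesis
    using imp_Cap[OF p(1) assms(2)] p(2) by simp
qed

text \<open>Implicativity for \<open>x\<^sup>\<star>\<close> and \<open>y\<^sup>\<star>\<close> is
  the case \<open>z = \<zero>\<close>; writing \<open>x \<rightarrow> z\<close> as
  \<open>z\<^sup>\<star> \<rightarrow> x\<^sup>\<star>\<close> reduces the general case to it by
  exchange.\<close>

lemma imp_imp_absorb: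
  assumes "x \<in> X" "y \<in> X" "z \<in> X"
  shows "(y \<rightarrow> x) \<rightarrow> (x \<rightarrow> z) = x \<rightarrow> z"
proof -
  have "(y \<rightarrow> x) \<rightarrow> x\<^sup>\<star> = x\<^sup>\<star>"
    using implicative[of "x\<^sup>\<star>" "y\<^sup>\<star>"] assms
    by (simp add: contraposition star_closed)
  moreover have "(y \<rightarrow> x) \<rightarrow> (z\<^sup>\<star> \<rightarrow> x\<^sup>\<star>) = z\<^sup>\<star> \<rightarrow> ((y \<rightarrow> x) \<rightarrow> x\<^sup>\<star>)"
    using assms by (intro exchange imp_closed star_closed)
  ultimately show ?thesis
    using assms by (simp add: contraposition)
qed

sublocale pre_Wajsberg_algebra
proof
  fix x y
  assume xy: "x \<in> X" "y \<in> X"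
  have "x \<rightarrow> y = x \<rightarrow> ((y \<rightarrow> x) \<rightarrow> (x \<sqinter> y))"
    using xy by (simp add: imp_Cap_eq)
  also have "\<dots> = (y \<rightarrow> x) \<rightarrow> (x \<rightarrow> (x \<sqinter> y))"
    using xy by (simp add: exchange imp_closed Cap_closed)
  also have "\<dots> = x \<rightarrow> (x \<sqinter> y)"
    using xy by (simp add: imp_imp_absorb Cap_closed)
  finally show "x \<rightarrow> (x \<sqinter> y) = x \<rightarrow> y" ..
qed

end

theorem corollary3p18:
  fixes X :: "'a set"
    and imp :: "'a \<Rightarrow> 'a \<Rightarrow> 'a"
    and one zero :: 'a
  assumes "involutive_BE_algebra X imp one zero"
    and "implicative_BE_algebra X imp one"
    and "implicative_orthomodular_algebra X imp one zero"
  shows "pre_Wajsberg_algebra X imp one zero \<and> meta_Wajsberg_algebra X imp one zero"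
proof -
  interpret implicative_IOM_algebra X imp one zero
    using assms(2,3) by (rule implicative_IOM_algebra.intro[rotated])
  show ?thesis
    using pre_Wajsberg_algebra_axioms meta_Wajsberg_algebra_axioms ..
qed

end
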